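(* Let $\beta\in(0,1)$ and let $M$ be geometric with $\mathbb{P}(M=m)=(1-\beta)\beta^{m-1}$ for $m=1,2,\dots$. Then the total number of comparisons used to compute the Russian-roulette estimator $\widehat\Delta$ (defined in the context) is $N=\sum_{m=1}^M m=\frac{M(M+1)}{2}$, and $$\mathbb{E}[N]=\frac{1}{(1-\beta)^2}.$$
   Context: Logistic comparison model: for a pair of points with gap $\Delta$ and temperature $\tau>0$, each comparison returns an independent $\mathrm{Bernoulli}(p)$ outcome, $p=\frac1{1+e^{-\Delta/\tau}}$. The estimator is $\widehat\Delta=\tau\sum_{m=1}^{M}\frac{A_m-B_m}{m\,q_m}$, $q_m=\mathbb{P}(M\ge m)$, where $M$ is independent of the comparisons and, for each $m\le M$, a fresh block of exactly $m$ comparisons is used to form $A_m$ (indicator that all $m$ outcomes are $1$) and $B_m$ (indicator that all $m$ outcomes are $0$). *)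

theory Defs
  imports "HOL-Probability.Probability"
begin

definition logistic_prob :: "real \<Rightarrow> real \<Rightarrow> real" where
  "logistic_prob \<Delta> \<tau> = 1 / (1 + exp (- \<Delta> / \<tau>))"

text \<open>
  The comparisons available for one pair of points are numbered by natural numbers; \<open>Y c\<close> is the
  outcome of comparison \<open>c\<close>, with \<open>True\<close> for outcome 1. The set \<open>block m\<close> holds the numbers of
  the comparisons that form \<open>A\<^sub>m\<close> and \<open>B\<^sub>m\<close>. Blocks are fresh, that is, pairwise disjoint; the layout
  is otherwise arbitrary.
  Measurability of \<open>Y c\<close> is part of \<open>indep_vars\<close>. Since \<open>indep_var\<close> requires both variables to have the
  same type, independence of \<open>M\<close> from the whole family \<open>Y\<close> is stated for the generated sigma-algebras.
\<close>

locale logistic_comparisons = prob_space P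
  for P :: "'a measure" +
  fixes \<Delta> \<tau> :: real
    and Y :: "nat \<Rightarrow> 'a \<Rightarrow> bool"
    and block :: "nat \<Rightarrow> nat set"
    and M :: "'a \<Rightarrow> nat"
  assumes tau_pos: "\<tau> > 0"
    and Y_bernoulli: "\<And>c. distr P (count_space UNIV) (Y c) =
                            measure_pmf (bernoulli_pmf (logistic_prob \<Delta> \<tau>))"
    and Y_indep: "indep_vars (\<lambda>_. count_space UNIV) Y UNIV"
    and M_measurable: "random_variable (count_space UNIV) M"
    and M_indep: "indep_set
                    (sets (vimage_algebra (space P) M (count_space UNIV)))
                    (sets (vimage_algebra (space P) (\<lambda>\<omega> c. Y c \<omega>)
                             (Pi\<^sub>M UNIV (\<lambda>_. count_space UNIV))))"
    and block_size: "\<And>m. m \<ge> 1 \<Longrightarrow> finite (block m) \<and> card (block m) = m"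
    and block_fresh: "disjoint_family_on block {1..}"

definition all_ones :: "(nat \<Rightarrow> 'a \<Rightarrow> bool) \<Rightarrow> (nat \<Rightarrow> nat set) \<Rightarrow> nat \<Rightarrow> 'a \<Rightarrow> real" where
  "all_ones Y block m \<omega> = of_bool (\<forall>c\<in>block m. Y c \<omega>)"

definition all_zeros :: "(nat \<Rightarrow> 'a \<Rightarrow> bool) \<Rightarrow> (nat \<Rightarrow> nat set) \<Rightarrow> nat \<Rightarrow> 'a \<Rightarrow> real" where
  "all_zeros Y block m \<omega> = of_bool (\<forall>c\<in>block m. \<not> Y c \<omega>)"

definition tail_prob :: "'a measure \<Rightarrow> ('a \<Rightarrow> nat) \<Rightarrow> nat \<Rightarrow> real" where
  "tail_prob P M m = measure P {\<omega> \<in> space P. M \<omega> \<ge> m}"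

definition roulette_estimator ::
  "'a measure \<Rightarrow> real \<Rightarrow> (nat \<Rightarrow> 'a \<Rightarrow> bool) \<Rightarrow> (nat \<Rightarrow> nat set) \<Rightarrow> ('a \<Rightarrow> nat) \<Rightarrow> 'a \<Rightarrow> real" where
  "roulette_estimator P \<tau> Y block M \<omega> =
     \<tau> * (\<Sum>m = 1..M \<omega>.
            (all_ones Y block m \<omega> - all_zeros Y block m \<omega>) / (real m * tail_prob P M m))"

definition comparisons_used :: "(nat \<Rightarrow> nat set) \<Rightarrow> ('a \<Rightarrow> nat) \<Rightarrow> 'a \<Rightarrow> nat set" where
  "comparisons_used block M \<omega> = (\<Union>m\<in>{1..M \<omega>}. block m)"

text \<open>The estimator reads no outcome outside \<open>comparisons_used\<close>.\<close>

lemma roulette_estimator_cong: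
  assumes "\<And>c. c \<in> comparisons_used block M \<omega> \<Longrightarrow> Y c \<omega> = Y' c \<omega>"
  shows "roulette_estimator P \<tau> Y block M \<omega> = roulette_estimator P \<tau> Y' block M \<omega>"
proof -
  have "all_ones Y block m \<omega> = all_ones Y' block m \<omega> \<and>
        all_zeros Y block m \<omega> = all_zeros Y' block m \<omega>" if "m \<in> {1..M \<omega>}" for m
  proof -
    have "\<forall>c\<in>block m. Y c \<omega> = Y' c \<omega>"
      using assms that unfolding comparisons_used_def by blast
    then show ?thesis
      by (simp add: all_ones_def all_zeros_def)
  qed
  then show ?thesis
    by (simp add: roulette_estimator_def)
qed

text \<open>
  Every comparison of a block counts, even if \<open>A\<^sub>m\<close> and \<open>B\<^sub>m\<close> are already determined
  by part of the block.
\<close>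

definition num_comparisons :: "(nat \<Rightarrow> nat set) \<Rightarrow> ('a \<Rightarrow> nat) \<Rightarrow> 'a \<Rightarrow> nat" where
  "num_comparisons block M \<omega> = card (comparisons_used block M \<omega>)"

end

theory Submission
  imports Defs "HOL-Real_Asymp.Real_Asymp"
begin

text \<open>Disjoint blocks of sizes 1, ..., M make N the M-th triangular number at every sample
  point (\<open>num_comparisons_eq\<close>), so E[N] is a series over the law of M
  (\<open>has_bochner_integral_nat_valued\<close>). In that series the factor 1 - \<beta> turns
  triangular numbers into their differences m, leaving the sum of m \<beta>^(m-1), the derivative of
  the geometric series (\<open>sums_triangular_geometric\<close>). Probabilistically, block m is
  paid for exactly when M \<ge> m, an event of probability \<beta>^(m-1).\<close>

lemma (in prob_space) has_bochner_integral_nat_valued: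
  fixes X :: "'a \<Rightarrow> nat" and f :: "nat \<Rightarrow> real"
  assumes [measurable]: "random_variable (count_space UNIV) X"
    and nonneg: "\<And>n. 0 \<le> f n"
    and sums: "(\<lambda>n. f n * prob {\<omega> \<in> space M. X \<omega> = n}) sums s"
  shows "has_bochner_integral M (\<lambda>\<omega>. f (X \<omega>)) s"
\<comment> \<open>For a nonnegative function, a finite integral in \<open>ennreal\<close> yields
  both integrability and the value, so the computation takes place there.\<close>
proof (rule has_bochner_integral_nn_integral)
  let ?A = "\<lambda>n. {\<omega> \<in> space M. X \<omega> = n}"
  \<comment> \<open>The level sets of \<open>X\<close> partition the space: at each point only the
    term n = \<open>X \<omega>\<close> survives.\<close>
  have "(\<integral>\<^sup>+\<omega>. ennreal (f (X \<omega>)) \<partial>M) = (\<integral>\<^sup>+\<omega>. (\<Sum>n. ennreal (f n) * indicator (?A n) \<omega>) \<partial>M)"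
  proof (rule nn_integral_cong)
    fix \<omega> assume "\<omega> \<in> space M"
    then have "(\<Sum>n. ennreal (f n) * indicator (?A n) \<omega>) =
        (\<Sum>n\<in>{X \<omega>}. ennreal (f n) * indicator (?A n) \<omega>)"
      by (intro suminf_finite) auto
    with \<open>\<omega> \<in> space M\<close> show "ennreal (f (X \<omega>)) = (\<Sum>n. ennreal (f n) * indicator (?A n) \<omega>)"
      by simp
  qed
  \<comment> \<open>Monotone convergence exchanges sum and integral.\<close>
  also have "\<dots> = (\<Sum>n. ennreal (f n) * emeasure M (?A n))"
    by (subst nn_integral_suminf) (simp_all add: nn_integral_cmult_indicator)
  also have "\<dots> = (\<Sum>n. ennreal (f n * prob (?A n)))"
    by (simp add: emeasure_eq_measure ennreal_mult nonneg)
  also have "\<dots> = ennreal s"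
    using sums by (intro suminf_ennreal_eq) (simp_all add: nonneg)
  finally show "(\<integral>\<^sup>+\<omega>. ennreal (f (X \<omega>)) \<partial>M) = ennreal s" .
  show "0 \<le> s"
    using sums_le[OF _ sums_zero sums] by (simp add: nonneg)
qed (use nonneg in auto)

lemma sums_triangular_geometric:
  fixes b :: real
  assumes "0 < b" "b < 1"
  shows "(\<lambda>n. real n * (real n + 1) / 2 * ((1 - b) * b ^ (n - 1))) sums (1 / (1 - b)\<^sup>2)"
proof -
  \<comment> \<open>Up to the telescoping difference of \<open>u\<close>, the term at \<open>Suc n\<close> is that of the derivative of the geometric series.\<close>
  define u where "u n = real n * (real n + 1) / 2 * b ^ n" for n
  have "u \<longlonglongrightarrow> 0"
    unfolding u_def using assms by real_asymp
  then have "(\<lambda>n. u n - u (Suc n)) sums (u 0 - 0)"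
    by (rule telescope_sums')
  moreover have "(\<lambda>n. real (Suc n) * b ^ n) sums (1 / (1 - b)\<^sup>2)"
    using geometric_deriv_sums[of b] assms by simp
  \<comment> \<open>The telescoping part contributes nothing, since \<open>u 0 = 0\<close>.\<close>
  ultimately have "(\<lambda>n. real (Suc n) * b ^ n + (u n - u (Suc n))) sums (1 / (1 - b)\<^sup>2)"
    using sums_add by (fastforce simp: u_def)
  also have "(\<lambda>n. real (Suc n) * b ^ n + (u n - u (Suc n))) =
      (\<lambda>n. real (Suc n) * (real (Suc n) + 1) / 2 * ((1 - b) * b ^ (Suc n - 1)))"
    by (rule ext) (simp add: u_def field_simps)
  finally show ?thesis
    \<comment> \<open>Shifting the index back adds the term at 0, which vanishes through its factor
      \<open>real n\<close>; the truncated exponent \<open>0 - 1\<close> is harmless there.\<close>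
    by (subst (asm) sums_Suc_iff) simp
qed

text \<open>Freshness is what rules out double counting: the cardinality of the union is the sum of
  the block sizes.\<close>

lemma (in logistic_comparisons) num_comparisons_eq:
  "num_comparisons block M \<omega> = (\<Sum>m = 1..M \<omega>. m)"
proof -
  have "card (\<Union>m\<in>{1..M \<omega>}. block m) = (\<Sum>m\<in>{1..M \<omega>}. card (block m))"
    using block_size block_fresh
    by (intro card_UN_disjoint) (auto simp: disjoint_family_on_def)
  also have "\<dots> = (\<Sum>m = 1..M \<omega>. m)"
    using block_size by (intro sum.cong) auto
  finally show ?thesis
    by (simp add: num_comparisons_def comparisons_used_def)
qed

theorem lemma3p3:
  fixes P :: "'a measure"
    and \<Delta> \<tau> \<beta> :: real
    and Y :: "nat \<Rightarrow> 'a \<Rightarrow> bool"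
    and block :: "nat \<Rightarrow> nat set"
    and M :: "'a \<Rightarrow> nat"
  assumes "logistic_comparisons P \<Delta> \<tau> Y block M"
    and "0 < \<beta>" and "\<beta> < 1"
    and "\<And>m. m \<ge> 1 \<Longrightarrow>
           measure P {\<omega> \<in> space P. M \<omega> = m} = (1 - \<beta>) * \<beta> ^ (m - 1)"
  shows "(\<forall>\<omega>\<in>space P.
            num_comparisons block M \<omega> = (\<Sum>m = 1..M \<omega>. m) \<and>
            real (num_comparisons block M \<omega>) = real (M \<omega>) * (real (M \<omega>) + 1) / 2) \<and>
         integrable P (\<lambda>\<omega>. real (num_comparisons block M \<omega>)) \<and>
         (\<integral>\<omega>. real (num_comparisons block M \<omega>) \<partial>P) = 1 / (1 - \<beta>)\<^sup>2"
proof -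
  interpret logistic_comparisons P \<Delta> \<tau> Y block M
    by fact
  let ?f = "\<lambda>n. real n * (real n + 1) / 2"
  have triangular: "real (num_comparisons block M \<omega>) = ?f (M \<omega>)" for \<omega>
    unfolding num_comparisons_eq using double_gauss_sum_from_Suc_0[of "M \<omega>", where ?'a = real]
    by simp
  have "(\<lambda>n. ?f n * prob {\<omega> \<in> space P. M \<omega> = n}) = (\<lambda>n. ?f n * ((1 - \<beta>) * \<beta> ^ (n - 1)))"
  proof
    show "?f n * prob {\<omega> \<in> space P. M \<omega> = n} = ?f n * ((1 - \<beta>) * \<beta> ^ (n - 1))" for n
      \<comment> \<open>The law of M is given for n \<ge> 1; at n = 0 both sides are 0 because of
        the factor \<open>real n\<close>.\<close>
      using assms(4)[of n] by (cases n) auto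
  qed
  then have "(\<lambda>n. ?f n * prob {\<omega> \<in> space P. M \<omega> = n}) sums (1 / (1 - \<beta>)\<^sup>2)"
    using sums_triangular_geometric[OF assms(2,3)] by (simp only:)
  then have "has_bochner_integral P (\<lambda>\<omega>. ?f (M \<omega>)) (1 / (1 - \<beta>)\<^sup>2)"
    by (intro has_bochner_integral_nat_valued M_measurable) simp_all
  then show ?thesis
    unfolding triangular by (simp add: has_bochner_integral_iff num_comparisons_eq)
qed

end
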